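(* Let $\alpha>1$ be a real algebraic number whose minimal polynomial over $\mathbb{Q}$ is $\mathfrak{m}_\alpha(X)=X^3-aX^2+bX-c$ with $a,b,c$ positive integers. Assume that $\alpha$ is the unique positive root of $\mathfrak{m}_\alpha$ and that the additive monoid $\mathbb{N}_0[\alpha]$ is atomic. Then $\mathbb{N}_0[\alpha]$ is infinitely generated if and only if $b^3>a^3c$.
   Context: $\mathbb{N}_0=\{0,1,2,\dots\}$. For $\alpha\in\mathbb{R}_{>0}$, $\mathbb{N}_0[\alpha]=\{f(\alpha): f(X)\in\mathbb{N}_0[X]\}\subseteq\mathbb{R}_{\ge 0}$, viewed as a commutative cancellative monoid under addition. For a commutative cancellative monoid $(M,+,0)$: a unit is an element with an additive inverse in $M$; a nonunit $u\in M\setminus\{0\}$ is an atom if $u=v+w$ with $v,w\in M$ implies that $v$ or $w$ is a unit; $M$ is atomic if every nonzero nonunit is a finite sum of atoms. $M$ is finitely generated if there is a finite subset $S\subseteq M$ such that every element of $M$ is a finite (possibly empty) sum of elements of $S$; infinitely generated means not finitely generated. *)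

theory Defs
  imports Complex_Main "HOL-Computational_Algebra.Computational_Algebra"
begin

(* In the four monoid-theoretic definitions below, M is meant to be a submonoid (containing 0 and
   closed under +) of the ambient cancellative type; all notions are relative to M. *)

definition monoid_unit :: "'a::cancel_comm_monoid_add set \<Rightarrow> 'a \<Rightarrow> bool" where
  "monoid_unit M u \<longleftrightarrow> u \<in> M \<and> (\<exists>v\<in>M. u + v = 0)"

definition monoid_atom :: "'a::cancel_comm_monoid_add set \<Rightarrow> 'a \<Rightarrow> bool" where
  "monoid_atom M u \<longleftrightarrow> u \<in> M - {0} \<and> \<not> monoid_unit M u \<and>
     (\<forall>v\<in>M. \<forall>w\<in>M. u = v + w \<longrightarrow> monoid_unit M v \<or> monoid_unit M w)"

definition atomic_monoid :: "'a::cancel_comm_monoid_add set \<Rightarrow> bool" where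
  "atomic_monoid M \<longleftrightarrow> (\<forall>u\<in>M - {0}. \<not> monoid_unit M u \<longrightarrow>
     (\<exists>xs. set xs \<subseteq> {x. monoid_atom M x} \<and> u = sum_list xs))"

definition finitely_generated_monoid :: "'a::cancel_comm_monoid_add set \<Rightarrow> bool" where
  "finitely_generated_monoid M \<longleftrightarrow>
     (\<exists>S\<subseteq>M. finite S \<and> (\<forall>u\<in>M. \<exists>xs. set xs \<subseteq> S \<and> u = sum_list xs))"

definition nat_adjoin :: "real \<Rightarrow> real set" where
  "nat_adjoin \<alpha> = {poly (map_poly of_nat f) \<alpha> | f :: nat poly. True}"

lemma zero_in_nat_adjoin: "0 \<in> nat_adjoin \<alpha>"
  unfolding nat_adjoin_def by (auto intro!: exI[of _ 0])

lemma add_in_nat_adjoin: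
  assumes "x \<in> nat_adjoin \<alpha>" "y \<in> nat_adjoin \<alpha>"
  shows "x + y \<in> nat_adjoin \<alpha>"
proof -
  obtain f g :: "nat poly"
    where "x = poly (map_poly of_nat f) \<alpha>" "y = poly (map_poly of_nat g) \<alpha>"
    using assms unfolding nat_adjoin_def by auto
  moreover have "map_poly of_nat (f + g) = map_poly of_nat f + (map_poly of_nat g :: real poly)"
    by (rule poly_eqI) (simp add: coeff_map_poly)
  ultimately have "x + y = poly (map_poly of_nat (f + g)) \<alpha>"
    by simp
  then show ?thesis unfolding nat_adjoin_def by blast
qed

definition is_minimal_polynomial :: "rat poly \<Rightarrow> real \<Rightarrow> bool" where
  "is_minimal_polynomial p x \<longleftrightarrow>
     lead_coeff p = 1 \<and> poly (map_poly of_rat p) x = 0 \<and>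
     (\<forall>q :: rat poly. q \<noteq> 0 \<and> poly (map_poly of_rat q) x = 0 \<longrightarrow> degree p \<le> degree q)"

end

theory Submission
  imports Defs
begin

text \<open>
  The monoid is finitely generated iff some \<open>\<alpha>\<^sup>n\<close> is a natural combination of lower powers of
  \<open>\<alpha>\<close>. Write the minimal polynomial as \<open>(X - \<alpha>)(X\<^sup>2 + pX + q)\<close>; since \<open>\<alpha>\<close> is its only positive root
  and it has no root \<open>\<le> 0\<close>, the quadratic factor has two non-real roots of modulus \<open>\<surd>q\<close>.
  Evaluating the minimal polynomial at the cube root of \<open>c\<close> shows that \<open>b\<^sup>3 > a\<^sup>3c\<close> iff \<open>\<surd>q > \<alpha>\<close>.

  If \<open>\<surd>q > \<alpha>\<close>, a relation \<open>\<alpha>\<^sup>n = \<Sum>\<^sub>i\<^sub><\<^sub>n c\<^sub>i\<alpha>\<^sup>i\<close> would also hold for the conjugates, which the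
  triangle inequality forbids. If \<open>\<surd>q < \<alpha>\<close>, work with the coordinates of the powers of \<open>\<alpha>\<close> with
  respect to \<open>1, \<alpha>, \<alpha>\<^sup>2\<close>. The quadratic factor has a multiple \<open>P\<close> with nonnegative coefficients, and
  \<open>X\<^sup>n\<close> agrees with \<open>(\<alpha>\<^sup>n / P(\<alpha>)) P\<close> modulo the minimal polynomial up to an error of order
  \<open>o(\<alpha>\<^sup>n)\<close>. So \<open>\<alpha>\<^sup>n\<close> lies deep inside the real cone spanned by finitely many powers
  of \<open>\<alpha>\<close>, and rounding the real coefficients down leaves a small remainder that can be absorbed.
\<close>

section \<open>Finite generation as a relation between powers\<close>

lemma nat_adjoin_eq:
  "nat_adjoin x = {(\<Sum>i<n. real (c i) * x ^ i) | n c. True}"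
proof (intro set_eqI iffI)
  fix y assume "y \<in> nat_adjoin x"
  then obtain f :: "nat poly" where f: "y = poly (map_poly of_nat f) x"
    unfolding nat_adjoin_def by auto
  have "degree (map_poly real f) = degree f"
    by (intro degree_map_poly) simp
  then have "y = (\<Sum>i<Suc (degree f). real (coeff f i) * x ^ i)"
    unfolding f poly_altdef lessThan_Suc_atMost by (simp add: coeff_map_poly)
  then show "y \<in> {(\<Sum>i<n. real (c i) * x ^ i) | n c. True}" by blast
next
  fix y assume "y \<in> {(\<Sum>i<n. real (c i) * x ^ i) | n c. True}"
  then obtain n c where y: "y = (\<Sum>i<n. real (c i) * x ^ i)" by blast
  have "(\<Sum>i<n. real (c i) * x ^ i) \<in> nat_adjoin x" for n
  proof (induction n)
    case 0
    then show ?case by (simp add: zero_in_nat_adjoin)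
  next
    case (Suc n)
    have "real (c n) * x ^ n = poly (map_poly of_nat (monom (c n) n)) x"
      by (simp add: map_poly_monom poly_monom)
    then have "real (c n) * x ^ n \<in> nat_adjoin x"
      unfolding nat_adjoin_def by blast
    with Suc show ?case by (simp add: add_in_nat_adjoin)
  qed
  with y show "y \<in> nat_adjoin x" by simp
qed

text \<open>Finitely many generators involve only powers below some n, so \<open>x ^ n\<close> is
  itself a combination of these. Conversely, one such relation, multiplied by x repeatedly, reduces
  every higher power to powers below n.\<close>

lemma finitely_generated_nat_adjoin_iff:
  "finitely_generated_monoid (nat_adjoin x) \<longleftrightarrow>
     (\<exists>n c. x ^ n = (\<Sum>i<n. real (c i) * x ^ i))"
proof -
  define T where "T n = {(\<Sum>i<n. real (c i) * x ^ i) | c. True}" for n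
  have T_adj: "nat_adjoin x = (\<Union>n. T n)"
    unfolding nat_adjoin_eq T_def by blast
  have T_0: "0 \<in> T n" for n
    unfolding T_def by (auto intro!: exI[of _ "\<lambda>_. 0"])
  have T_add: "u + v \<in> T n" if "u \<in> T n" "v \<in> T n" for u v n
  proof -
    from that obtain c d where "u = (\<Sum>i<n. real (c i) * x ^ i)" "v = (\<Sum>i<n. real (d i) * x ^ i)"
      unfolding T_def by blast
    then have "u + v = (\<Sum>i<n. real (c i + d i) * x ^ i)"
      by (simp add: sum.distrib algebra_simps)
    then show ?thesis unfolding T_def by (intro CollectI exI[of _ "\<lambda>i. c i + d i"]) simp
  qed
  have T_scale: "real k * u \<in> T n" if "u \<in> T n" for u n k
    by (induction k) (use that in \<open>auto simp: T_0 algebra_simps intro: T_add\<close>)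
  have T_Suc: "T n \<subseteq> T (Suc n)" for n
  proof
    fix u assume "u \<in> T n"
    then obtain c where "u = (\<Sum>i<n. real (c i) * x ^ i)" unfolding T_def by blast
    then have "u = (\<Sum>i<Suc n. real ((c(n := 0)) i) * x ^ i)" by simp
    then show "u \<in> T (Suc n)" unfolding T_def by blast
  qed
  have T_mono: "T k \<subseteq> T n" if "k \<le> n" for k n
    using that by (rule lift_Suc_mono_le[of T, OF T_Suc])
  have T_power: "x ^ k \<in> T n" if "k < n" for k n
  proof -
    have "(\<Sum>i<n. real (if i = k then 1 else 0) * x ^ i) = (\<Sum>i<n. if i = k then x ^ i else 0)"
      by (intro sum.cong) auto
    also have "\<dots> = x ^ k" using that by simp
    finally show ?thesis unfolding T_def by (intro CollectI exI[of _ "\<lambda>i. if i = k then 1 else 0"]) simp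
  qed
  show ?thesis
  proof
    assume "finitely_generated_monoid (nat_adjoin x)"
    then obtain S where S: "S \<subseteq> nat_adjoin x" "finite S"
      and gen: "\<And>u. u \<in> nat_adjoin x \<Longrightarrow> \<exists>xs. set xs \<subseteq> S \<and> u = sum_list xs"
      unfolding finitely_generated_monoid_def by blast
    have "\<exists>n. S \<subseteq> T n"
      using S(2,1)
    proof (induction S)
      case (insert s S)
      then obtain n k where "S \<subseteq> T n" "s \<in> T k" unfolding T_adj by auto
      then have "insert s S \<subseteq> T (max n k)"
        using T_mono[of n "max n k"] T_mono[of k "max n k"] by auto
      then show ?case by blast
    qed simp
    then obtain n where n: "S \<subseteq> T n" by blast
    have "x ^ n \<in> nat_adjoin x" unfolding T_adj using T_power[of n "Suc n"] by blast
    then obtain xs where xs: "set xs \<subseteq> S" "x ^ n = sum_list xs" using gen by blast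
    have "set ys \<subseteq> S \<Longrightarrow> sum_list ys \<in> T n" for ys
      by (induction ys) (use n in \<open>auto simp: T_0 intro: T_add\<close>)
    with xs have "x ^ n \<in> T n" by simp
    then show "\<exists>n c. x ^ n = (\<Sum>i<n. real (c i) * x ^ i)" unfolding T_def by blast
  next
    assume "\<exists>n c. x ^ n = (\<Sum>i<n. real (c i) * x ^ i)"
    then obtain n where n: "x ^ n \<in> T n" unfolding T_def by blast
    define S where "S = (\<lambda>i. x ^ i) ` {..<n}"
    define G where "G = {sum_list xs | xs. set xs \<subseteq> S}"
    have T_lower: "x ^ k \<in> T n" for k
    proof (induction k)
      case 0
      show ?case using n T_power[of 0 n] by (cases n) auto
    next
      case (Suc k)
      then obtain c where c: "x ^ k = (\<Sum>i<n. real (c i) * x ^ i)" unfolding T_def by blast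
      \<comment> \<open>The shift by x leaves the range of exponents only at \<open>x ^ n\<close>,
        which the given relation rewrites.\<close>
      have "x * (\<Sum>i<j. real (c i) * x ^ i) \<in> T n" if "j \<le> n" for j
        using that
      proof (induction j)
        case (Suc j)
        have "x ^ Suc j \<in> T n" using Suc.prems n T_power[of "Suc j" n] by (cases "Suc j = n") auto
        from T_scale[OF this, of "c j"] Suc show ?case
          by (simp add: distrib_left T_add mult.left_commute)
      qed (simp add: T_0)
      then show ?case by (simp add: c)
    qed
    have T_le: "T k \<subseteq> T n" for k
    proof
      fix u assume "u \<in> T k"
      then obtain c where u: "u = (\<Sum>i<k. real (c i) * x ^ i)" unfolding T_def by blast
      have "(\<Sum>i<j. real (c i) * x ^ i) \<in> T n" for j
        by (induction j) (auto simp: T_0 intro: T_add T_scale T_lower)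
      then show "u \<in> T n" by (simp add: u)
    qed
    have G_add: "u + v \<in> G" if "u \<in> G" "v \<in> G" for u v
    proof -
      from that obtain xs ys where "u + v = sum_list (xs @ ys)" "set (xs @ ys) \<subseteq> S"
        unfolding G_def by auto
      then show ?thesis unfolding G_def by blast
    qed
    have G_0: "0 \<in> G" unfolding G_def by (auto intro!: exI[of _ "[]"])
    have G_scale: "real k * u \<in> G" if "u \<in> G" for u k
      by (induction k) (use that in \<open>auto simp: G_0 algebra_simps intro: G_add\<close>)
    have G_S: "u \<in> G" if "u \<in> S" for u
      unfolding G_def using that by (auto intro!: exI[of _ "[u]"])
    have "T n \<subseteq> G"
    proof
      fix u assume "u \<in> T n"
      then obtain c where u: "u = (\<Sum>i<n. real (c i) * x ^ i)" unfolding T_def by blast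
      have "(\<Sum>i<j. real (c i) * x ^ i) \<in> G" if "j \<le> n" for j
        using that
      proof (induction j)
        case (Suc j)
        then have "x ^ j \<in> S" unfolding S_def by auto
        with Suc show ?case by (auto intro: G_add G_scale G_S)
      qed (simp add: G_0)
      then show "u \<in> G" by (simp add: u)
    qed
    with T_le have "nat_adjoin x \<subseteq> G" unfolding T_adj by blast
    moreover have "S \<subseteq> nat_adjoin x" unfolding S_def T_adj using T_power by blast
    moreover have "finite S" unfolding S_def by simp
    ultimately show "finitely_generated_monoid (nat_adjoin x)"
      unfolding finitely_generated_monoid_def G_def by (intro exI[of _ S]) auto
  qed
qed

section \<open>Second-order recurrences\<close>

text \<open>The linear functional sending X^i to \<open>\<rho> i\<close> kills X^k (X^2 + pX + q)
  for every k by the recurrence, hence every multiple of the quadratic.\<close>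

lemma recurrence_annihilated:
  fixes \<rho> :: "nat \<Rightarrow> 'a::comm_ring_1"
  assumes "\<And>n. \<rho> (n + 2) + p * \<rho> (n + 1) + q * \<rho> n = 0"
    and "degree (u * [:q, p, 1:]) \<le> N"
  shows "(\<Sum>i\<le>N. coeff (u * [:q, p, 1:]) i * \<rho> i) = 0"
proof -
  define L where "L f e = (\<Sum>i\<le>degree f. coeff f i * e i)" for f and e :: "nat \<Rightarrow> 'a"
  have L: "L f e = (\<Sum>i\<le>n. coeff f i * e i)" if "degree f \<le> n" for f e n
    unfolding L_def using that
    by (intro sum.mono_neutral_left) (auto simp: coeff_eq_0)
  have L_add: "L (f + g) e = L f e + L g e" for f g e
  proof -
    let ?n = "max (degree f) (degree g)"
    show ?thesis
      using L[of "f + g" ?n e] L[of f ?n e] L[of g ?n e]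
      by (simp add: degree_add_le sum.distrib algebra_simps)
  qed
  have L_pCons: "L (pCons k f) e = k * e 0 + L f (\<lambda>n. e (Suc n))" for k f e
  proof -
    have "L (pCons k f) e = (\<Sum>i\<le>Suc (degree f). coeff (pCons k f) i * e i)"
      by (rule L) (simp add: degree_pCons_le)
    also have "\<dots> = k * e 0 + L f (\<lambda>n. e (Suc n))"
      by (subst sum.atMost_Suc_shift) (simp add: L_def)
    finally show ?thesis .
  qed
  have L_0: "L 0 e = 0" for e by (simp add: L_def)
  have "L (u * [:q, p, 1:]) \<rho> = 0"
    using assms(1)
  proof (induction u arbitrary: \<rho>)
    case 0
    then show ?case by (simp add: L_0)
  next
    case (pCons k u)
    \<comment> \<open>Multiplication by X becomes a shift of the sequence, and the shifted sequence
      satisfies the same recurrence.\<close>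
    have IH: "L (u * [:q, p, 1:]) (\<lambda>n. \<rho> (Suc n)) = 0"
      by (rule pCons.IH) (use pCons.prems[of "Suc n" for n] in simp)
    have "L (smult k [:q, p, 1:]) \<rho> = k * (\<rho> 2 + p * \<rho> 1 + q * \<rho> 0)"
      by (simp add: L_pCons L_0 numeral_2_eq_2 algebra_simps)
    also have "\<dots> = 0" using pCons.prems[of 0] by (simp add: numeral_2_eq_2)
    finally have "L (smult k [:q, p, 1:]) \<rho> = 0" .
    then show ?case
      using IH by (simp only: mult_pCons_left L_add L_pCons) simp
  qed
  then show ?thesis using L[OF assms(2), of \<rho>] by simp
qed

text \<open>The quadratic form \<open>E\<close> below is \<open>|\<rho> (n + 1) - \<beta> \<rho> n|\<^sup>2\<close> for a root \<open>\<beta>\<close> of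
  \<open>X\<^sup>2 + pX + q\<close>, hence it is multiplied by \<open>|\<beta>|\<^sup>2 = q\<close> in each step.\<close>

lemma recurrence_decay:
  fixes \<rho> :: "nat \<Rightarrow> real"
  assumes rec: "\<And>n. \<rho> (n + 2) + p * \<rho> (n + 1) + q * \<rho> n = 0"
    and disc: "p\<^sup>2 < 4 * q" and "x > 0" "q < x\<^sup>2"
  shows "(\<lambda>n. \<rho> n / x ^ n) \<longlonglongrightarrow> 0"
proof -
  have q: "q > 0" using disc zero_le_power2[of p] by linarith
  define E where "E n = (\<rho> (n + 1))\<^sup>2 + p * \<rho> (n + 1) * \<rho> n + q * (\<rho> n)\<^sup>2" for n
  have E_Suc: "E (Suc n) = q * E n" for n
  proof -
    have "\<rho> (n + 2) = - p * \<rho> (n + 1) - q * \<rho> n" using rec[of n] by simp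
    then have "\<rho> (Suc n + 1) = - p * \<rho> (n + 1) - q * \<rho> n" by simp
    then show ?thesis unfolding E_def by (simp add: power2_eq_square) (simp add: algebra_simps)
  qed
  have E: "E n = q ^ n * E 0" for n by (induction n) (auto simp: E_Suc)
  \<comment> \<open>The coefficient of \<open>(\<rho> n)\<^sup>2\<close> left in \<open>E n\<close>
    after completing the square.\<close>
  define d where "d = q - p\<^sup>2 / 4"
  have d: "d > 0" using disc by (simp add: d_def)
  have E_ge: "d * (\<rho> n)\<^sup>2 \<le> E n" for n
  proof -
    have "E n - d * (\<rho> n)\<^sup>2 = (\<rho> (n + 1) + p / 2 * \<rho> n)\<^sup>2"
      unfolding E_def d_def by (simp add: power2_eq_square algebra_simps)
    then show ?thesis using zero_le_power2[of "\<rho> (n + 1) + p / 2 * \<rho> n"] by linarith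
  qed
  have bound: "(\<rho> n / x ^ n)\<^sup>2 \<le> E 0 / d * (q / x\<^sup>2) ^ n" for n
  proof -
    have "(\<rho> n)\<^sup>2 \<le> E 0 / d * q ^ n"
      using E_ge[of n] d unfolding E[of n] by (simp add: field_simps)
    then have "(\<rho> n)\<^sup>2 / (x ^ n)\<^sup>2 \<le> E 0 / d * q ^ n / (x ^ n)\<^sup>2"
      by (intro divide_right_mono) auto
    moreover have "(x\<^sup>2) ^ n = (x ^ n)\<^sup>2" by (simp only: power_mult[symmetric] mult.commute)
    ultimately show ?thesis by (simp add: power_divide)
  qed
  have "(\<lambda>n. (q / x\<^sup>2) ^ n) \<longlonglongrightarrow> 0"
    using assms q by (intro LIMSEQ_power_zero) simp
  then have "(\<lambda>n. E 0 / d * (q / x\<^sup>2) ^ n) \<longlonglongrightarrow> 0"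
    by (rule tendsto_mult_right_zero)
  then have "(\<lambda>n. (\<rho> n / x ^ n)\<^sup>2) \<longlonglongrightarrow> 0"
    by (rule tendsto_sandwich[OF _ _ tendsto_const, rotated 2])
       (use bound in \<open>simp_all only: eventually_True zero_le_power2\<close>)
  from tendsto_real_sqrt[OF this] show ?thesis
    by (simp only: real_sqrt_abs real_sqrt_zero tendsto_rabs_zero_iff)
qed

section \<open>Multiples with nonnegative coefficients\<close>

lemma nonneg_coeff_mult:
  fixes f g :: "'a::linordered_semidom poly"
  assumes "\<And>i. coeff f i \<ge> 0" "\<And>i. coeff g i \<ge> 0"
  shows "coeff (f * g) i \<ge> 0"
  unfolding coeff_mult by (intro sum_nonneg mult_nonneg_nonneg assms)

lemma nonneg_coeff_pcompose:
  fixes f g :: "'a::linordered_idom poly"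
  assumes "\<And>i. coeff f i \<ge> 0" "\<And>i. coeff g i \<ge> 0"
  shows "coeff (pcompose f g) i \<ge> 0"
  using assms(1)
proof (induction f arbitrary: i)
  case (pCons k f)
  have "k \<ge> 0" using pCons.prems[of 0] by simp
  have "coeff f i \<ge> 0" for i using pCons.prems[of "Suc i"] by simp
  from pCons.IH[OF this] have "coeff (g * pcompose f g) i \<ge> 0"
    by (intro nonneg_coeff_mult assms) auto
  with \<open>k \<ge> 0\<close> show ?case by (auto simp: pcompose_pCons coeff_pCons split: nat.split)
qed simp

text \<open>Multiplying by \<open>X\<^sup>2 - pX + q\<close> gives a quadratic polynomial in \<open>X\<^sup>2\<close> whose roots have twice the
  argument. Repeating this moves the roots into the left half plane; the quantity \<open>2 \<surd>q + p\<close>,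
  relative to \<open>\<surd>q\<close>, at least doubles in each step.\<close>

lemma quadratic_nonneg_multiple:
  fixes p q :: real
  assumes "p\<^sup>2 < 4 * q"
  obtains u where "\<And>i. coeff (u * [:q, p, 1:]) i \<ge> 0" "coeff (u * [:q, p, 1:]) 0 > 0"
proof -
  have q: "q > 0" using assms zero_le_power2[of p] by linarith
  have "\<exists>u. (\<forall>i. coeff (u * [:q, p, 1:]) i \<ge> 0) \<and> coeff (u * [:q, p, 1:]) 0 > 0"
    if "q > 0" "2 ^ N * (2 * sqrt q + p) \<ge> 2 * sqrt q" for N
    using that
  proof (induction N arbitrary: p q)
    case 0
    \<comment> \<open>For N = 0 the bound says p \<ge> 0, so the quadratic itself serves.\<close>
    then show ?case by (intro exI[of _ 1]) (auto simp: coeff_pCons split: nat.split)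
  next
    case (Suc N)
    show ?case
    proof (cases "p \<ge> 0")
      case True
      then show ?thesis using Suc.prems by (intro exI[of _ 1]) (auto simp: coeff_pCons split: nat.split)
    next
      case False
      \<comment> \<open>The middle coefficient of (X^2 - pX + q)(X^2 + pX + q) = X^4 + p' X^2 + q^2.
        The new quantity 2q + p' is (2 sqrt q + p)(2 sqrt q - p), whose second factor is at least 2
        sqrt q.\<close>
      define p' where "p' = 2 * q - p\<^sup>2"
      have sq: "sqrt q > 0" "(sqrt q)\<^sup>2 = q" using Suc.prems by auto
      have "2 ^ N * (2 * sqrt q + p) \<ge> sqrt q" using Suc.prems by simp
      moreover have "2 * sqrt q - p \<ge> 2 * sqrt q" using False by simp
      ultimately have "sqrt q * (2 * sqrt q) \<le> 2 ^ N * (2 * sqrt q + p) * (2 * sqrt q - p)"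
        using sq(1) by (intro mult_mono) (auto intro: order.trans[of 0 "sqrt q"] less_imp_le)
      also have "\<dots> = 2 ^ N * (2 * sqrt (q\<^sup>2) + p')"
        using sq Suc.prems by (simp add: p'_def power2_eq_square algebra_simps)
      also have "sqrt q * (2 * sqrt q) = 2 * sqrt (q\<^sup>2)"
        using sq Suc.prems by (simp add: power2_eq_square)
      finally have "2 ^ N * (2 * sqrt (q\<^sup>2) + p') \<ge> 2 * sqrt (q\<^sup>2)" .
      then obtain u where u: "\<And>i. coeff (u * [:q\<^sup>2, p', 1:]) i \<ge> 0" "coeff (u * [:q\<^sup>2, p', 1:]) 0 > 0"
        using Suc.IH[of "q\<^sup>2" p'] Suc.prems(1) by auto
      have "pcompose [:q\<^sup>2, p', 1:] [:0, 0, 1:] = [:q, - p, 1:] * [:q, p, 1:]"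
        by (simp add: pcompose_pCons p'_def power2_eq_square algebra_simps)
      then have eq: "pcompose (u * [:q\<^sup>2, p', 1:]) [:0, 0, 1:] = (pcompose u [:0, 0, 1:] * [:q, - p, 1:]) * [:q, p, 1:]"
        by (simp only: pcompose_mult mult.assoc)
      have "coeff (pcompose (u * [:q\<^sup>2, p', 1:]) [:0, 0, 1:]) i \<ge> 0" for i
        by (intro nonneg_coeff_pcompose u) (auto simp: coeff_pCons split: nat.split)
      moreover have "coeff (pcompose (u * [:q\<^sup>2, p', 1:]) [:0, 0, 1:]) 0 > 0"
        using u(2) by (simp only: flip: poly_0_coeff_0) (simp add: poly_pcompose)
      ultimately show ?thesis unfolding eq by blast
    qed
  qed
  moreover have "\<exists>N. 2 ^ N * (2 * sqrt q + p) \<ge> 2 * sqrt q"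
  proof -
    have "\<bar>p\<bar> < sqrt (4 * q)" using assms by (simp add: real_less_rsqrt)
    then have pos: "2 * sqrt q + p > 0" by (simp add: real_sqrt_mult)
    obtain N where "2 * sqrt q / (2 * sqrt q + p) < 2 ^ N"
      using real_arch_pow[of 2] by auto
    with pos show ?thesis by (auto simp: field_simps intro!: exI[of _ N])
  qed
  ultimately show ?thesis using q that by blast
qed


section \<open>Non-real quadratics and a bound on conjugates\<close>

lemma quadratic_pos:
  fixes p q y :: real
  assumes "p\<^sup>2 < 4 * q"
  shows "y\<^sup>2 + p * y + q > 0"
proof -
  have "y\<^sup>2 + p * y + q = (y + p / 2)\<^sup>2 + (q - p\<^sup>2 / 4)"
    by (simp add: power2_eq_square algebra_simps)
  with assms zero_le_power2[of "y + p / 2"] show ?thesis by linarith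
qed

text \<open>For y = |z| > x, dividing the relation by the (n-1)-st power makes the right side
  nonincreasing in the base, while the left side is the base itself. The triangle inequality for z
  then contradicts the equality for x.\<close>

lemma power_sum_root_bound:
  fixes z :: complex and x :: real and c :: "nat \<Rightarrow> nat"
  assumes "x > 0"
    and x: "x ^ n = (\<Sum>i<n. real (c i) * x ^ i)"
    and z: "z ^ n = (\<Sum>i<n. of_nat (c i) * z ^ i)"
  shows "cmod z \<le> x"
proof (rule ccontr)
  assume "\<not> cmod z \<le> x"
  define y where "y = cmod z"
  have y: "x < y" using \<open>\<not> cmod z \<le> x\<close> by (simp add: y_def)
  \<comment> \<open>For n = 0 the relation would read 1 = 0.\<close>
  obtain k where k: "n = Suc k" using x by (cases n) auto
  have "y ^ n = cmod (\<Sum>i<n. of_nat (c i) * z ^ i)"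
    by (simp add: y_def norm_power flip: z)
  also have "\<dots> \<le> (\<Sum>i<n. real (c i) * y ^ i)"
    by (rule order.trans[OF norm_sum]) (simp add: y_def norm_mult norm_power)
  finally have "y ^ n * x ^ k \<le> (\<Sum>i<n. real (c i) * y ^ i) * x ^ k"
    using \<open>x > 0\<close> by (intro mult_right_mono) auto
  also have "\<dots> \<le> (\<Sum>i<n. real (c i) * x ^ i) * y ^ k"
    unfolding sum_distrib_right
  proof (rule sum_mono)
    fix i assume "i \<in> {..<n}"
    then have i: "k = i + (k - i)" by (simp add: k)
    have "x ^ (k - i) \<le> y ^ (k - i)" using y \<open>x > 0\<close> by (intro power_mono) auto
    then have "(real (c i) * y ^ i * x ^ i) * x ^ (k - i) \<le> (real (c i) * y ^ i * x ^ i) * y ^ (k - i)"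
      using y \<open>x > 0\<close> by (intro mult_left_mono) auto
    then show "real (c i) * y ^ i * x ^ k \<le> real (c i) * x ^ i * y ^ k"
      by (subst (1 2) i) (simp only: power_add mult_ac)
  qed
  also have "\<dots> = x ^ n * y ^ k" by (simp add: x)
  finally have "y * (y ^ k * x ^ k) \<le> x * (y ^ k * x ^ k)" by (simp add: k mult_ac)
  then show False using y \<open>x > 0\<close> by simp
qed

section \<open>A dominant real root gives finite generation\<close>

text \<open>The recurrence with characteristic polynomial X^3 - aX^2 + bX - c. Started from a unit
  vector, it gives one coordinate of the powers of a root.\<close>

fun cubic_rec :: "'a::comm_ring_1 \<Rightarrow> 'a \<Rightarrow> 'a \<Rightarrow> (nat \<Rightarrow> 'a) \<Rightarrow> nat \<Rightarrow> 'a" where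
  "cubic_rec a b c v 0 = v 0"
| "cubic_rec a b c v (Suc 0) = v 1"
| "cubic_rec a b c v (Suc (Suc 0)) = v 2"
| "cubic_rec a b c v (Suc (Suc (Suc n))) =
     a * cubic_rec a b c v (Suc (Suc n)) - b * cubic_rec a b c v (Suc n) + c * cubic_rec a b c v n"

text \<open>The first three hypotheses are the factorization X^3 - aX^2 + bX - c = (X - x)(X^2 + pX
  + q); \<open>q < x\<^sup>2\<close> makes x exceed the other two roots in modulus.\<close>

lemma dominant_root_imp_power_sum:
  fixes x p q :: real and a b c :: int
  assumes a: "of_int a = x - p" and b: "of_int b = q - x * p" and c: "of_int c = x * q"
    and disc: "p\<^sup>2 < 4 * q" and "q < x\<^sup>2" and x: "x > 1"
  shows "\<exists>n d. x ^ n = (\<Sum>i<n. real (d i) * x ^ i)"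
proof -
  define e :: "nat \<Rightarrow> nat \<Rightarrow> int" where "e j = cubic_rec a b c (\<lambda>i. if i = j then 1 else 0)" for j
  have e_init: "e j i = (if i = j then 1 else 0)" if "i \<le> 2" for i j
  proof -
    from that consider "i = 0" | "i = Suc 0" | "i = Suc (Suc 0)" by linarith
    then show ?thesis by cases (auto simp: e_def)
  qed
  have e_rec: "real_of_int (e j (n + 3)) = (x - p) * e j (n + 2) - (q - x * p) * e j (n + 1) + x * q * e j n" for j n
    unfolding e_def by (simp add: eval_nat_numeral a b c)
  have x_power: "x ^ n = (\<Sum>j\<le>2. e j n * x ^ j)" for n
  proof -
    \<comment> \<open>Three consecutive powers are carried along because the recurrence has order
      three.\<close>
    have "x ^ n = (\<Sum>j\<le>2. e j n * x ^ j) \<and> x ^ (n + 1) = (\<Sum>j\<le>2. e j (n + 1) * x ^ j)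
      \<and> x ^ (n + 2) = (\<Sum>j\<le>2. e j (n + 2) * x ^ j)"
    proof (induction n)
      case 0
      show ?case by (simp add: e_init eval_nat_numeral)
    next
      case (Suc n)
      have "x ^ (n + 3) = (x - p) * x ^ (n + 2) - (q - x * p) * x ^ (n + 1) + x * q * x ^ n"
        by (simp add: algebra_simps eval_nat_numeral)
      also have "\<dots> = (\<Sum>j\<le>2. e j (n + 3) * x ^ j)"
        unfolding e_rec conjunct1[OF Suc.IH] conjunct1[OF conjunct2[OF Suc.IH]] conjunct2[OF conjunct2[OF Suc.IH]]
        by (simp add: sum_distrib_left sum.distrib sum_subtractf algebra_simps)
      finally have "x ^ (Suc n + 2) = (\<Sum>j\<le>2. e j (Suc n + 2) * x ^ j)"
        by (simp add: numeral_3_eq_3 numeral_2_eq_2)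
      with Suc.IH show ?case by (simp only: Suc_eq_plus1 add.assoc one_add_one simp_thms)
    qed
    then show ?thesis by simp
  qed

  \<comment> \<open>\<open>s j * x ^ n\<close> is the dominant part of the \<open>j\<close>-th coordinate \<open>e j n\<close> of \<open>x ^ n\<close>.\<close>
  define s where "s j = (e j 2 + p * e j 1 + q * e j 0) / (x\<^sup>2 + p * x + q)" for j
  define \<rho> where "\<rho> j n = e j n - s j * x ^ n" for j n
  have h_pos: "x\<^sup>2 + p * x + q > 0"
    using disc by (rule quadratic_pos)
  have \<rho>_rec: "\<rho> j (n + 2) + p * \<rho> j (n + 1) + q * \<rho> j n = 0" for j n
  proof -
    \<comment> \<open>The quadratic factor of the characteristic polynomial, applied to
      \<open>e j\<close>, leaves a geometric sequence of ratio x; \<open>s j\<close> is chosen to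
      match it.\<close>
    have "e j (n + 2) + p * e j (n + 1) + q * e j n = x ^ n * (e j 2 + p * e j 1 + q * e j 0)"
    proof (induction n)
      case (Suc n)
      have "e j (Suc n + 2) + p * e j (Suc n + 1) + q * e j (Suc n)
        = x * (e j (n + 2) + p * e j (n + 1) + q * e j n)"
        using e_rec[of j n] by (simp add: algebra_simps eval_nat_numeral)
      with Suc.IH show ?case by simp
    qed (simp add: numeral_2_eq_2)
    also have "\<dots> = x ^ n * (s j * (x\<^sup>2 + p * x + q))"
      using h_pos by (simp add: s_def)
    finally show ?thesis
      by (simp add: \<rho>_def algebra_simps power2_eq_square)
  qed
  have \<rho>_decay: "(\<lambda>n. \<rho> j n / x ^ n) \<longlonglongrightarrow> 0" for j
    using recurrence_decay[of "\<rho> j" p q x, OF \<rho>_rec disc] x \<open>q < x\<^sup>2\<close> by simp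

  obtain u where u: "\<And>i. coeff (u * [:q, p, 1:]) i \<ge> 0" "coeff (u * [:q, p, 1:]) 0 > 0"
    using quadratic_nonneg_multiple[OF disc] by blast
  \<comment> \<open>The factor \<open>1 + X + X\<^sup>2\<close> makes the first three coefficients strictly positive.\<close>
  define P where "P = [:1, 1, 1:] * u * [:q, p, 1:]"
  have P: "P = [:1, 1, 1:] * (u * [:q, p, 1:])" by (simp only: P_def mult.assoc)
  have P_nonneg: "coeff P i \<ge> 0" for i
    unfolding P by (intro nonneg_coeff_mult u) (auto simp: coeff_pCons split: nat.split)
  have P_pos: "coeff P i > 0" if "i \<le> 2" for i
  proof -
    define Q where "Q = u * [:q, p, 1:]"
    from that consider "i = 0" | "i = Suc 0" | "i = Suc (Suc 0)" by linarith
    then show ?thesis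
      unfolding P Q_def[symmetric] using u(1)[of 1] u(1)[of 2] u(2) unfolding Q_def[symmetric]
      by cases (auto simp: coeff_pCons numeral_2_eq_2)
  qed
  \<comment> \<open>The maximum keeps the basis exponents 0, 1, 2 in range.\<close>
  define D where "D = max 2 (degree P)"
  define Px where "Px = (\<Sum>i\<le>D. coeff P i * x ^ i)"
  have Px: "Px > 0"
    unfolding Px_def using P_nonneg P_pos[of 0] x
    by (intro sum_pos2[where i = 0]) auto
  \<comment> \<open>As a multiple of the quadratic, P kills \<open>\<rho> j\<close>, so only the
    dominant part remains.\<close>
  have P_e: "(\<Sum>i\<le>D. coeff P i * e j i) = s j * Px" for j
  proof -
    have "(\<Sum>i\<le>D. coeff P i * \<rho> j i) = 0"
      unfolding P_def by (rule recurrence_annihilated[OF \<rho>_rec]) (simp add: D_def P_def)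
    then show ?thesis
      by (simp add: \<rho>_def Px_def right_diff_distrib sum_subtractf sum_distrib_left mult.left_commute)
  qed

  \<comment> \<open>\<open>K\<close> bounds every coordinate of the error made by rounding the coefficients down.\<close>
  define K where "K = (\<Sum>j\<le>2. \<Sum>i\<le>D. \<bar>e j i\<bar>)"
  have K: "(\<Sum>i\<le>D. \<bar>e j i\<bar>) \<le> K" if "j \<le> 2" for j
    unfolding K_def using that by (intro member_le_sum) (auto intro: sum_nonneg)
  \<comment> \<open>After division by \<open>x ^ n\<close> this tends to
    \<open>coeff P j / Px\<close>, which is positive.\<close>
  have "eventually (\<lambda>n. x ^ n * coeff P j / Px + \<rho> j n - K \<ge> 0) sequentially" if "j \<le> 2" for j
  proof -
    have "(\<lambda>n. 1 / x ^ n) \<longlonglongrightarrow> 0"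
      using LIMSEQ_power_zero[of "1 / x"] x by (simp add: power_one_over)
    then have "(\<lambda>n. coeff P j / Px + \<rho> j n / x ^ n - K * (1 / x ^ n)) \<longlonglongrightarrow> coeff P j / Px + 0 - real_of_int K * 0"
      by (intro tendsto_intros \<rho>_decay tendsto_mult_left) auto
    moreover have "coeff P j / Px + 0 - real_of_int K * 0 > 0" using P_pos[OF that] Px by simp
    ultimately have "eventually (\<lambda>n. coeff P j / Px + \<rho> j n / x ^ n - K * (1 / x ^ n) > 0) sequentially"
      by (rule order_tendstoD(1))
    then show ?thesis
    proof eventually_elim
      case (elim n)
      then have "x ^ n * (coeff P j / Px + \<rho> j n / x ^ n - K * (1 / x ^ n)) \<ge> 0"
        using x by (intro mult_nonneg_nonneg) auto
      then show ?case using x by (simp add: algebra_simps)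
    qed
  qed
  then have "eventually (\<lambda>n. \<forall>j\<in>{..2}. x ^ n * coeff P j / Px + \<rho> j n - K \<ge> 0) sequentially"
    by (intro eventually_ball_finite) auto
  \<comment> \<open>\<open>n > D\<close> ensures that only powers below \<open>x ^ n\<close> are
    used.\<close>
  then have "eventually (\<lambda>n. (\<forall>j\<in>{..2}. x ^ n * coeff P j / Px + \<rho> j n - K \<ge> 0) \<and> n > D) sequentially"
    by (intro eventually_conj eventually_gt_at_top)
  then obtain n where n: "\<And>j. j \<le> 2 \<Longrightarrow> x ^ n * coeff P j / Px + \<rho> j n - K \<ge> 0" "n > D"
    by (auto simp: eventually_sequentially)

  have cut: "(\<Sum>i\<le>D. if i \<le> 2 then f i else 0) = (\<Sum>i\<le>2. f i)" for f :: "nat \<Rightarrow> real"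
  proof -
    have "{i \<in> {..D}. i \<le> 2} = {..2}" by (auto simp: D_def)
    then show ?thesis by (simp flip: sum.inter_filter)
  qed
  \<comment> \<open>Real coefficients for \<open>x ^ n\<close> minus a reserve K in each coordinate:
    the multiple of P supplies the dominant part, the first three terms the correction.\<close>
  define t where "t i = x ^ n * coeff P i / Px + (if i \<le> 2 then \<rho> i n - K else 0)" for i
  have t_nonneg: "t i \<ge> 0" for i
    using n(1)[of i] P_nonneg[of i] Px x by (auto simp: t_def)
  have t_e: "(\<Sum>i\<le>D. t i * e j i) = e j n - K" if "j \<le> 2" for j
  proof -
    have "(\<Sum>i\<le>D. t i * e j i) = x ^ n / Px * (\<Sum>i\<le>D. coeff P i * e j i)
        + (\<Sum>i\<le>D. if i \<le> 2 then (\<rho> i n - K) * e j i else 0)"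
      unfolding sum_distrib_left sum.distrib[symmetric] by (intro sum.cong) (auto simp: t_def algebra_simps)
    also have "(\<Sum>i\<le>D. if i \<le> 2 then (\<rho> i n - K) * e j i else 0) = (\<Sum>i\<le>2. if i = j then \<rho> i n - K else 0)"
      unfolding cut by (intro sum.cong) (auto simp: e_init)
    also have "\<dots> = \<rho> j n - K" using that by simp
    finally show ?thesis using Px by (simp add: P_e \<rho>_def)
  qed
  \<comment> \<open>The integer coordinates lost by rounding; adding back the reserve K makes them
    nonnegative.\<close>
  define r where "r j = e j n - K - (\<Sum>i\<le>D. \<lfloor>t i\<rfloor> * e j i)" for j
  have r: "K + r j \<ge> 0" if "j \<le> 2" for j
  proof -
    have "real_of_int (r j) = (\<Sum>i\<le>D. frac (t i) * e j i)"
      using t_e[OF that] by (simp add: r_def frac_def left_diff_distrib sum_subtractf)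
    also have "\<bar>\<dots>\<bar> \<le> (\<Sum>i\<le>D. \<bar>frac (t i) * e j i\<bar>)" by (rule sum_abs)
    also have "\<dots> \<le> (\<Sum>i\<le>D. \<bar>real_of_int (e j i)\<bar>)"
      by (intro sum_mono) (auto simp: abs_mult less_imp_le[OF frac_lt_1] intro: mult_left_le_one_le)
    also have "\<dots> = real_of_int (\<Sum>i\<le>D. \<bar>e j i\<bar>)" by simp
    finally have "\<bar>r j\<bar> \<le> (\<Sum>i\<le>D. \<bar>e j i\<bar>)" by linarith
    with K[OF that] show ?thesis by linarith
  qed
  define d where "d i = (if i \<le> D then nat \<lfloor>t i\<rfloor> + (if i \<le> 2 then nat (K + r i) else 0) else 0)" for i
  have "(\<Sum>i<n. real (d i) * x ^ i) = (\<Sum>i\<le>D. real (d i) * x ^ i)"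
    using n(2) by (intro sum.mono_neutral_right) (auto simp: d_def)
  also have "\<dots> = (\<Sum>i\<le>D. \<lfloor>t i\<rfloor> * x ^ i) + (\<Sum>i\<le>D. if i \<le> 2 then (K + r i) * x ^ i else 0)"
    unfolding sum.distrib[symmetric] using r t_nonneg
    by (intro sum.cong) (auto simp: d_def algebra_simps)
  also have "(\<Sum>i\<le>D. if i \<le> 2 then (K + r i) * x ^ i else 0) = (\<Sum>j\<le>2. (K + r j) * x ^ j)"
    by (rule cut)
  also have "(\<Sum>i\<le>D. \<lfloor>t i\<rfloor> * x ^ i) = (\<Sum>j\<le>2. (\<Sum>i\<le>D. \<lfloor>t i\<rfloor> * e j i) * x ^ j)"
  proof -
    have "(\<Sum>i\<le>D. \<lfloor>t i\<rfloor> * x ^ i) = (\<Sum>i\<le>D. \<Sum>j\<le>2. \<lfloor>t i\<rfloor> * e j i * x ^ j)"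
      by (subst x_power) (simp only: sum_distrib_left of_int_mult mult.assoc)
    also have "\<dots> = (\<Sum>j\<le>2. \<Sum>i\<le>D. \<lfloor>t i\<rfloor> * e j i * x ^ j)" by (rule sum.swap)
    finally show ?thesis by (simp add: sum_distrib_right)
  qed
  also have "(\<Sum>j\<le>2. (\<Sum>i\<le>D. \<lfloor>t i\<rfloor> * e j i) * x ^ j) + (\<Sum>j\<le>2. (K + r j) * x ^ j)
      = (\<Sum>j\<le>2. e j n * x ^ j)"
    unfolding sum.distrib[symmetric] by (intro sum.cong) (auto simp: r_def algebra_simps)
  also have "\<dots> = x ^ n" by (rule x_power[symmetric])
  finally show ?thesis by (intro exI[of _ n] exI[of _ d]) simp
qed

section \<open>Minimal polynomials over the rationals\<close>

lemma map_poly_of_rat_add: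
  "map_poly of_rat (f + g) = (map_poly of_rat f + map_poly of_rat g :: 'a::field_char_0 poly)"
  by (rule poly_eqI) (simp add: coeff_map_poly of_rat_add)

lemma map_poly_of_rat_mult:
  "map_poly of_rat (f * g) = (map_poly of_rat f * map_poly of_rat g :: 'a::field_char_0 poly)"
  by (rule poly_eqI) (simp add: coeff_map_poly coeff_mult of_rat_sum of_rat_mult)

text \<open>The remainder modulo m also vanishes at x, so minimality of the degree forces it to be
  zero. This transfers relations to the conjugates.\<close>

lemma minimal_polynomial_dvd:
  assumes "is_minimal_polynomial m x" and "poly (map_poly of_rat f) x = 0"
  shows "m dvd f"
proof (rule ccontr)
  assume "\<not> m dvd f"
  then have nz: "f mod m \<noteq> 0" by (simp add: mod_eq_0_iff_dvd)
  have "m \<noteq> 0" "poly (map_poly of_rat m) x = 0"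
    using assms(1) by (auto simp: is_minimal_polynomial_def)
  have "f = f div m * m + f mod m" by simp
  then have "map_poly of_rat f = map_poly of_rat (f div m) * map_poly of_rat m + (map_poly of_rat (f mod m) :: real poly)"
    by (metis map_poly_of_rat_add map_poly_of_rat_mult)
  then have "poly (map_poly of_rat (f mod m)) x = 0"
    using assms(2) \<open>poly (map_poly of_rat m) x = 0\<close> by simp
  with nz have "degree m \<le> degree (f mod m)"
    using assms(1) by (auto simp: is_minimal_polynomial_def)
  with degree_mod_less'[OF \<open>m \<noteq> 0\<close> nz] show False by simp
qed

lemma minimal_polynomial_degree_one_if_Rats:
  assumes "is_minimal_polynomial m x" and "x \<in> \<rat>"
  shows "degree m \<le> 1"
proof -
  obtain r where "x = of_rat r" using assms(2) by (auto elim: Rats_cases)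
  then have "poly (map_poly of_rat [:- r, 1:]) x = 0" by (simp add: map_poly_pCons of_rat_minus)
  then have "degree m \<le> degree [:- r, 1:]"
    using assms(1) unfolding is_minimal_polynomial_def by (metis pCons_eq_0_iff zero_neq_one)
  then show ?thesis by simp
qed

section \<open>Comparison of the conjugates with \<alpha>\<close>

theorem corollary1:
  fixes \<alpha> :: real and a b c :: int and m :: "rat poly"
  assumes "\<alpha> > 1" and "algebraic \<alpha>"
    and "is_minimal_polynomial m \<alpha>"
    and "m = [:- of_int c, of_int b, - of_int a, 1:]"
    and "a > 0" and "b > 0" and "c > 0"
    and "{x :: real. x > 0 \<and> poly (map_poly of_rat m) x = 0} = {\<alpha>}"
    and "atomic_monoid (nat_adjoin \<alpha>)"
  shows "\<not> finitely_generated_monoid (nat_adjoin \<alpha>) \<longleftrightarrow> b ^ 3 > a ^ 3 * c"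
proof -
  define M where "M y = y ^ 3 - a * y\<^sup>2 + b * y - c" for y :: real
  have M: "poly (map_poly of_rat m) y = M y" for y
    unfolding assms(4) M_def
    by (simp add: map_poly_pCons of_rat_minus algebra_simps power2_eq_square power3_eq_cube)
  have irr: "\<alpha> \<notin> \<rat>"
    using minimal_polynomial_degree_one_if_Rats[OF assms(3)] by (auto simp: assms(4))
  have root: "M \<alpha> = 0" and unique: "\<And>y. y > 0 \<Longrightarrow> M y = 0 \<Longrightarrow> y = \<alpha>"
    using assms(8) by (auto simp: M)
  \<comment> \<open>p and q come from comparing the X^2 and constant coefficients in (X -
    \<alpha>)(X^2 + pX + q).\<close>
  define p where "p = \<alpha> - a"
  define q where "q = c / \<alpha>"
  have a: "real_of_int a = \<alpha> - p" by (simp add: p_def)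
  have c: "real_of_int c = \<alpha> * q" using \<open>\<alpha> > 1\<close> by (simp add: q_def)
  have b: "real_of_int b = q - \<alpha> * p"
  proof -
    have "\<alpha> * b = \<alpha> * (q - \<alpha> * p)"
      using root unfolding M_def a c by (simp add: algebra_simps power2_eq_square power3_eq_cube)
    with \<open>\<alpha> > 1\<close> show ?thesis by simp
  qed
  have factor: "M y = (y - \<alpha>) * (y\<^sup>2 + p * y + q)" for y
    unfolding M_def a b c by (simp add: algebra_simps power2_eq_square power3_eq_cube)
  \<comment> \<open>Real roots of the quadratic would both equal \<alpha>, since M is negative on y
    \<le> 0. Then a = 3\<alpha>, against irrationality.\<close>
  have disc: "p\<^sup>2 < 4 * q"
  proof (rule ccontr)
    assume "\<not> p\<^sup>2 < 4 * q"
    define w where "w = sqrt (p\<^sup>2 - 4 * q)"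
    have w: "w\<^sup>2 = p\<^sup>2 - 4 * q" using \<open>\<not> p\<^sup>2 < 4 * q\<close> by (simp add: w_def)
    have real_root: "y = \<alpha>" if "y\<^sup>2 + p * y + q = 0" for y
    proof -
      have "M y = 0" using that by (simp add: factor)
      moreover have "M y < 0" if "y \<le> 0"
      proof -
        have "y ^ 3 \<le> 0" "a * y\<^sup>2 \<ge> 0" "b * y \<le> 0"
          using that \<open>a > 0\<close> \<open>b > 0\<close> by (auto simp: power_le_zero_eq mult_nonneg_nonpos)
        with \<open>c > 0\<close> show ?thesis unfolding M_def by linarith
      qed
      ultimately show ?thesis using unique[of y] by force
    qed
    have "(- p + w) / 2 = \<alpha>" "(- p - w) / 2 = \<alpha>"
      using w by (intro real_root; simp add: power2_eq_square field_simps)+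
    then have "\<alpha> = a / 3" unfolding a by (simp add: field_simps)
    with irr show False by simp
  qed
  have h_pos: "y\<^sup>2 + p * y + q > 0" for y
    using disc by (rule quadratic_pos)
  define w where "w = root 3 c"
  have w: "w > 0" "w ^ 3 = c" using \<open>c > 0\<close> by (simp_all add: w_def)
  \<comment> \<open>The cubic and constant terms cancel, so the sign of \<open>M w\<close> compares
    b with \<open>a * w\<close>; by \<open>factor\<close> it also compares w with \<alpha>.\<close>
  have M_w: "M w = w * (b - a * w)"
    unfolding M_def w(2) by (simp add: algebra_simps power2_eq_square)
  have w_less: "\<alpha> < w \<longleftrightarrow> a ^ 3 * c < b ^ 3"
  proof -
    have "\<alpha> < w \<longleftrightarrow> M w > 0" using h_pos[of w] by (simp add: factor zero_less_mult_iff)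
    also have "\<dots> \<longleftrightarrow> a * w < b" using w by (simp add: M_w zero_less_mult_iff)
    also have "\<dots> \<longleftrightarrow> (a * w) ^ 3 < real_of_int b ^ 3"
      using w \<open>a > 0\<close> \<open>b > 0\<close> by (simp add: power_mono_iff flip: not_le)
    also have "\<dots> \<longleftrightarrow> real_of_int (a ^ 3 * c) < real_of_int (b ^ 3)"
      by (simp add: power_mult_distrib w(2))
    finally show ?thesis by (simp only: of_int_less_iff)
  qed
  \<comment> \<open>Excludes the boundary case of three roots of equal modulus.\<close>
  have w_neq: "w \<noteq> \<alpha>"
  proof
    assume "w = \<alpha>"
    then have "\<alpha> = b / a" using M_w root w \<open>a > 0\<close> by (simp add: field_simps)
    with irr show False by simp
  qed
  have q_iff: "\<alpha>\<^sup>2 < q \<longleftrightarrow> \<alpha> < w" "q < \<alpha>\<^sup>2 \<longleftrightarrow> w < \<alpha>"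
  proof -
    have "\<alpha> ^ 3 = \<alpha> * \<alpha>\<^sup>2" by (simp add: power2_eq_square power3_eq_cube)
    then have "\<alpha>\<^sup>2 < q \<longleftrightarrow> \<alpha> ^ 3 < w ^ 3" "q < \<alpha>\<^sup>2 \<longleftrightarrow> w ^ 3 < \<alpha> ^ 3"
      using \<open>\<alpha> > 1\<close> unfolding w(2) c by simp_all
    moreover have "\<alpha> ^ 3 < w ^ 3 \<longleftrightarrow> \<alpha> < w" "w ^ 3 < \<alpha> ^ 3 \<longleftrightarrow> w < \<alpha>"
      using w(1) \<open>\<alpha> > 1\<close> by (auto simp: power_strict_mono intro: power_less_imp_less_base)
    ultimately show "\<alpha>\<^sup>2 < q \<longleftrightarrow> \<alpha> < w" "q < \<alpha>\<^sup>2 \<longleftrightarrow> w < \<alpha>"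
      by simp_all
  qed
  show ?thesis
  proof (cases "\<alpha> < w")
    case True
    define z where "z = Complex (- p / 2) (sqrt (q - p\<^sup>2 / 4))"
    have z: "z\<^sup>2 + p * z + q = 0"
      using disc by (simp add: z_def complex_eq_iff power2_eq_square field_simps)
    have "cmod z = sqrt q"
      using disc by (simp add: z_def cmod_def power_divide)
    moreover have "sqrt q > \<alpha>" using True \<open>\<alpha> > 1\<close> by (intro real_less_rsqrt) (simp add: q_iff)
    ultimately have z_large: "cmod z > \<alpha>" by simp
    have "\<not> finitely_generated_monoid (nat_adjoin \<alpha>)"
    proof
      assume "finitely_generated_monoid (nat_adjoin \<alpha>)"
      then obtain n and d :: "nat \<Rightarrow> nat" where d: "\<alpha> ^ n = (\<Sum>i<n. real (d i) * \<alpha> ^ i)"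
        unfolding finitely_generated_nat_adjoin_iff by blast
      define g :: "rat poly" where "g = monom 1 n - (\<Sum>i<n. monom (of_nat (d i)) i)"
      \<comment> \<open>Generic in the field, for evaluation at the real \<alpha> and at the complex
        z.\<close>
      have coeff_g: "map_poly of_rat g = monom 1 n - (\<Sum>i<n. monom (of_nat (d i)) i :: 'a::field_char_0 poly)"
        by (rule poly_eqI)
           (auto simp: g_def coeff_map_poly coeff_sum of_rat_diff of_rat_sum of_rat_minus intro!: arg_cong2[of _ _ _ _ "(-)"] sum.cong)
      have "poly (map_poly of_rat g) \<alpha> = 0"
        by (simp add: coeff_g poly_sum poly_monom d)
      then have "m dvd g" using assms(3) by (rule minimal_polynomial_dvd[rotated])
      then obtain k where "g = m * k" by (elim dvdE)
      moreover have "poly (map_poly of_rat m) z = (z - \<alpha>) * (z\<^sup>2 + p * z + q)"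
      proof -
        have of_int_c: "of_int i = complex_of_real (real_of_int i)" for i by simp
        show ?thesis unfolding assms(4)
          by (simp add: map_poly_pCons of_rat_minus of_int_c a b c del: of_real_of_int_eq)
             (simp add: algebra_simps power2_eq_square)
      qed
      ultimately have "poly (map_poly of_rat g) z = 0"
        by (simp add: map_poly_of_rat_mult z)
      then have "z ^ n = (\<Sum>i<n. of_nat (d i) * z ^ i)"
        by (simp add: coeff_g poly_sum poly_monom)
      from power_sum_root_bound[OF _ d this] z_large \<open>\<alpha> > 1\<close> show False by simp
    qed
    with True w_less show ?thesis by simp
  next
    case False
    then have "q < \<alpha>\<^sup>2" using w_neq by (simp add: q_iff)
    from dominant_root_imp_power_sum[OF a b c disc this \<open>\<alpha> > 1\<close>]
    have "finitely_generated_monoid (nat_adjoin \<alpha>)"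
      by (simp add: finitely_generated_nat_adjoin_iff)
    with False w_less show ?thesis by simp
  qed
qed

end
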